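(* Let $a,b,c>0$ be integers with $\lcm(a,c)=b$. Then $c/\mathrm{alcm}_a b$ is an integer which divides $a$ and is coprime with $\mathrm{alcm}_a b$.
   Context: For integers $a,b>0$ with $a\mid b$, the anti-lcm $\mathrm{alcm}_a b$ of $b$ with respect to $a$ is the smallest positive integer $c$ such that $\lcm(a,c)=b$. *)

theory Defs
  imports Main
begin

(* Meaningful for 0 < a, 0 < b, a dvd b: the set of candidates is then nonempty
   (it contains b), so LEAST really denotes its minimum. *)
definition alcm :: "nat \<Rightarrow> nat \<Rightarrow> nat" where
  "alcm a b = (LEAST c. 0 < c \<and> lcm a c = b)"

lemma alcm_pos_and_lcm:
  assumes "0 < b" "a dvd b"
  shows "0 < alcm a b \<and> lcm a (alcm a b) = b"
  unfolding alcm_def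
  by (rule LeastI[where k = b]) (use assms in \<open>simp add: lcm_proj2_if_dvd_nat\<close>)

lemma alcm_le:
  assumes "0 < c" "lcm a c = b"
  shows "alcm a b \<le> c"
  unfolding alcm_def by (rule Least_le) (use assms in simp)

end

theory Submission
  imports Defs "HOL-Computational_Algebra.Primes"
begin

text \<open>
  The solutions \<open>c\<close> of \<open>lcm a c = b\<close> are closed under \<open>gcd\<close>, because the divisibility lattice is
  distributive; hence the least solution \<open>m\<close> divides every solution \<open>c = m * k\<close>. If \<open>k\<close> and \<open>m\<close>
  had a common divisor \<open>d > 1\<close>, then comparing \<open>lcm a m = lcm a (m * d)\<close> shows that \<open>m div d\<close>
  would be a smaller solution. So \<open>k\<close> is coprime to \<open>m\<close>, and \<open>k dvd lcm a m\<close> forces \<open>k dvd a\<close>.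
\<close>

lemma lcm_gcd_eqI_nat:
  fixes a b c d :: nat
  assumes "lcm a c = b" "lcm a d = b"
  shows "lcm a (gcd c d) = b"
  using assms by (simp add: lcm_gcd_distrib)

text \<open>At each prime dividing \<open>d\<close>, the equality forces the exponent in
  \<open>a\<close> to be at least that in \<open>n * d * d\<close>, so dropping a factor
  \<open>d\<close> changes nothing.\<close>

lemma lcm_eq_lcm_mult_imp_lcm_eq_nat:
  fixes a n d :: nat
  assumes "0 < a" "0 < n" "0 < d"
    and "lcm a (n * d) = lcm a (n * d * d)"
  shows "lcm a n = lcm a (n * d)"
proof -
  \<comment> \<open>Since lcm times gcd is the product, equal lcms make the gcds differ by the
    factor \<open>d\<close>.\<close>
  have "lcm a (n * d) * gcd a (n * d * d) = lcm a (n * d * d) * gcd a (n * d * d)"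
    using assms(4) by simp
  also have "\<dots> = a * (n * d) * d"
    by simp
  also have "\<dots> = lcm a (n * d) * (gcd a (n * d) * d)"
    by (metis lcm_mult_gcd mult.assoc normalize_nat_def id_apply)
  finally have "gcd a (n * d * d) = gcd a (n * d) * d"
    using assms(1-3) by (metis lcm_eq_0_iff mult_cancel_left mult_pos_pos not_gr_zero)
  then have "gcd a (n * d) * d dvd a"
    by (metis gcd_dvd1)
  then have "gcd a n * d dvd a"
    by (meson dvd_trans dvd_triv_left gcd_mono dvd_refl mult_dvd_mono)
  then have "gcd a n * d dvd gcd a (n * d)"
    by (simp add: mult_dvd_mono)
  moreover have "gcd a (n * d) dvd gcd a n * d"
    by (metis gcd_dvd1 gcd_dvd2 gcd_greatest gcd_mult_distrib_nat dvd_mult mult.commute)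
  ultimately have "gcd a (n * d) = gcd a n * d"
    by (simp add: dvd_antisym)
  then have "lcm a n * (gcd a n * d) = lcm a (n * d) * (gcd a n * d)"
    by (metis lcm_mult_gcd mult.assoc normalize_nat_def id_apply)
  then show ?thesis
    using assms by simp
qed

theorem theorem16:
  fixes a b c :: nat
  assumes "0 < a" "0 < b" "0 < c"
    and "lcm a c = b"
  shows "alcm a b dvd c
    \<and> (c div alcm a b) dvd a
    \<and> coprime (c div alcm a b) (alcm a b)"
proof -
  define m where "m = alcm a b"
  have "a dvd b"
    using assms(4) by auto
  then have m: "0 < m" "lcm a m = b"
    using alcm_pos_and_lcm[OF assms(2)] by (simp_all add: m_def)
  have m_le: "m \<le> x" if "0 < x" "lcm a x = b" for x
    using alcm_le[OF that] by (simp add: m_def)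
  have "m \<le> gcd m c"
    using m_le[of "gcd m c"] m(1) lcm_gcd_eqI_nat[OF m(2) assms(4)] by simp
  then have "gcd m c = m"
    using m(1) by (simp add: gcd_le1_nat le_antisym)
  then have "m dvd c"
    by (metis gcd_dvd2)
  then obtain k where k: "c = m * k" ..
  define d where "d = gcd k m"
  obtain n where n: "m = n * d"
    unfolding d_def by (metis gcd_dvd2 dvd_def mult.commute)
  have pos: "0 < n" "0 < d"
    using m(1) n by auto
  \<comment> \<open>As \<open>d\<close> divides \<open>k\<close>, \<open>m * d\<close> divides
    \<open>c\<close>; so \<open>lcm a (m * d)\<close> is squeezed between \<open>lcm a m = b\<close>
    and \<open>b\<close>.\<close>
  have "m * d dvd b"
    using assms(4) k unfolding d_def by (metis dvd_lcm2 dvd_trans gcd_dvd1 mult_dvd_mono dvd_refl)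
  then have "lcm a (m * d) dvd b"
    using \<open>a dvd b\<close> by simp
  moreover have "b dvd lcm a (m * d)"
    unfolding m(2)[symmetric] by (simp add: dvd_lcmI2)
  ultimately have "lcm a (n * d) = lcm a (n * d * d)"
    using m(2) n by (simp add: dvd_antisym)
  then have "lcm a n = b"
    using lcm_eq_lcm_mult_imp_lcm_eq_nat[OF assms(1) pos] m(2) n by simp
  then have "n * d \<le> n"
    using m_le pos n by simp
  then have "d = 1"
    using pos by simp
  then have cop: "coprime k m"
    by (simp add: d_def coprime_iff_gcd_eq_1)
  have "k dvd b"
    using assms(4) k by auto
  then have "k dvd a * m"
    using m(2) by (metis dvd_trans dvd_triv_left dvd_triv_right lcm_least)
  then have "k dvd a"
    using cop by (simp add: coprime_dvd_mult_left_iff)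
  then show ?thesis
    using cop k m(1) by (simp flip: m_def)
qed

end
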